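(* Let $G=(V,E)$ be a graph and suppose a strong elimination ordering of $V$ is given. Then, for any $\mathbf k,\mathbf u\in\mathbb{Z}_+^V$, both GDF and GPF on the instance $(G,\mathbf k,\mathbf u)$ can be solved in $O(|V|+|E|)$ time.
   Context: Graphs are finite, simple, undirected; $N[v]$ (or $N_H[v]$ in a graph $H$) is the closed neighborhood; $f(U)=\sum_{x\in U}f(x)$. A vertex is simplicial if its closed neighborhood is a clique. For an ordering $(v_1,\dots,v_n)$ of $V$, let $G_i=G[\{v_i,\dots,v_n\}]$. The ordering is a strong elimination ordering if for every $i\in[n]$, $v_i$ is simplicial in $G_i$, and for all $j,k$ with $i\leq j\leq k$ and $\{v_j,v_k\}\subseteq N_{G_i}[v_i]$, we have $N_{G_i}[v_j]\subseteq N_{G_i}[v_k]$. (Graphs admitting such an ordering are strongly chordal.) GDF (resp. GPF): given $G$ and $\mathbf k,\mathbf u\in\mathbb{Z}_+^V$, compute the minimum (resp. maximum) of $f(V)$ over all $f:V\to\mathbb{Z}_+$ with $f(v)\leq u(v)$ and $f(N[v])\geq k(v)$ (resp. $f(N[v])\leq k(v)$) for all $v\in V$. *)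

theory Defs
  imports Complex_Main "HOL-Library.Landau_Symbols"
begin

section \<open>Graphs and strong elimination orderings\<close>

definition simple_graph :: "'a set \<Rightarrow> 'a set set \<Rightarrow> bool" where
  "simple_graph V E \<longleftrightarrow> finite V \<and> (\<forall>e\<in>E. e \<subseteq> V \<and> card e = 2)"

definition closed_nbhd :: "'a set \<Rightarrow> 'a set set \<Rightarrow> 'a \<Rightarrow> 'a set" where
  "closed_nbhd V E v = {w \<in> V. w = v \<or> {v, w} \<in> E}"

definition induced_edges :: "'a set set \<Rightarrow> 'a set \<Rightarrow> 'a set set" where
  "induced_edges E W = {e \<in> E. e \<subseteq> W}"

definition clique :: "'a set \<Rightarrow> 'a set set \<Rightarrow> 'a set \<Rightarrow> bool" where
  "clique V E K \<longleftrightarrow> K \<subseteq> V \<and> (\<forall>x\<in>K. \<forall>y\<in>K. x \<noteq> y \<longrightarrow> {x, y} \<in> E)"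

definition simplicial :: "'a set \<Rightarrow> 'a set set \<Rightarrow> 'a \<Rightarrow> bool" where
  "simplicial V E v \<longleftrightarrow> v \<in> V \<and> clique V E (closed_nbhd V E v)"

text \<open>Positions in the list \<open>vs\<close> are counted from 0, so the vertex set of \<open>G\<^sub>i\<close> is
  \<open>set (drop i vs)\<close>.\<close>

definition strong_elimination_ordering :: "'a set \<Rightarrow> 'a set set \<Rightarrow> 'a list \<Rightarrow> bool" where
  "strong_elimination_ordering V E vs \<longleftrightarrow>
     distinct vs \<and> set vs = V \<and>
     (\<forall>i<length vs.
        let W = set (drop i vs); F = induced_edges E W in
          simplicial W F (vs ! i) \<and>
          (\<forall>j k. i \<le> j \<and> j \<le> k \<and> k < length vs \<and>
                 {vs ! j, vs ! k} \<subseteq> closed_nbhd W F (vs ! i) \<longrightarrow>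
                 closed_nbhd W F (vs ! j) \<subseteq> closed_nbhd W F (vs ! k)))"

section \<open>The two optimization problems\<close>

definition gdf_feasible ::
    "'a set \<Rightarrow> 'a set set \<Rightarrow> ('a \<Rightarrow> nat) \<Rightarrow> ('a \<Rightarrow> nat) \<Rightarrow> ('a \<Rightarrow> nat) \<Rightarrow> bool" where
  "gdf_feasible V E k u f \<longleftrightarrow> (\<forall>v\<in>V. f v \<le> u v \<and> sum f (closed_nbhd V E v) \<ge> k v)"

definition gpf_feasible ::
    "'a set \<Rightarrow> 'a set set \<Rightarrow> ('a \<Rightarrow> nat) \<Rightarrow> ('a \<Rightarrow> nat) \<Rightarrow> ('a \<Rightarrow> nat) \<Rightarrow> bool" where
  "gpf_feasible V E k u f \<longleftrightarrow> (\<forall>v\<in>V. f v \<le> u v \<and> sum f (closed_nbhd V E v) \<le> k v)"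

definition is_gdf_minimum ::
    "'a set \<Rightarrow> 'a set set \<Rightarrow> ('a \<Rightarrow> nat) \<Rightarrow> ('a \<Rightarrow> nat) \<Rightarrow> nat \<Rightarrow> bool" where
  "is_gdf_minimum V E k u m \<longleftrightarrow>
     (\<exists>f. gdf_feasible V E k u f \<and> sum f V = m) \<and>
     (\<forall>f. gdf_feasible V E k u f \<longrightarrow> m \<le> sum f V)"

definition is_gpf_maximum ::
    "'a set \<Rightarrow> 'a set set \<Rightarrow> ('a \<Rightarrow> nat) \<Rightarrow> ('a \<Rightarrow> nat) \<Rightarrow> nat \<Rightarrow> bool" where
  "is_gpf_maximum V E k u m \<longleftrightarrow>
     (\<exists>f. gpf_feasible V E k u f \<and> sum f V = m) \<and>
     (\<forall>f. gpf_feasible V E k u f \<longrightarrow> sum f V \<le> m)"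

section \<open>Unit-cost random access machine\<close>

text \<open>Structured programs for a RAM on natural numbers. The memory consists of named arrays; a
  program mentions finitely many of them, and a scalar variable is cell 0 of an array. The only
  arithmetic is addition and truncated subtraction (no multiplication or shifts, which would make
  the unit-cost measure unrealistic). Every operator, constant, memory access, test and assignment
  costs one step.\<close>

type_synonym mem = "string \<Rightarrow> nat \<Rightarrow> nat"

datatype aexp = Const nat | Load string aexp | Add aexp aexp | Sub aexp aexp

datatype bexp = Less aexp aexp | Neg bexp | Conj bexp bexp

datatype com =
    Skip
  | Store string aexp aexp  \<comment> \<open>array, index, value\<close>
  | Seq com com
  | Cond bexp com com
  | While bexp com

primrec aval :: "aexp \<Rightarrow> mem \<Rightarrow> nat" where
  "aval (Const c) s = c"
| "aval (Load x a) s = s x (aval a s)"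
| "aval (Add a b) s = aval a s + aval b s"
| "aval (Sub a b) s = aval a s - aval b s"

primrec acost :: "aexp \<Rightarrow> nat" where
  "acost (Const c) = 1"
| "acost (Load x a) = 1 + acost a"
| "acost (Add a b) = 1 + acost a + acost b"
| "acost (Sub a b) = 1 + acost a + acost b"

primrec bval :: "bexp \<Rightarrow> mem \<Rightarrow> bool" where
  "bval (Less a b) s \<longleftrightarrow> aval a s < aval b s"
| "bval (Neg b) s \<longleftrightarrow> \<not> bval b s"
| "bval (Conj b c) s \<longleftrightarrow> bval b s \<and> bval c s"

primrec bcost :: "bexp \<Rightarrow> nat" where
  "bcost (Less a b) = 1 + acost a + acost b"
| "bcost (Neg b) = 1 + bcost b"
| "bcost (Conj b c) = 1 + bcost b + bcost c"

text \<open>\<open>exec c s t s'\<close>: started in memory \<open>s\<close>, program \<open>c\<close> halts after exactly \<open>t\<close> steps in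
  memory \<open>s'\<close>.\<close>

inductive exec :: "com \<Rightarrow> mem \<Rightarrow> nat \<Rightarrow> mem \<Rightarrow> bool" where
  Skip: "exec Skip s 1 s"
| Store: "exec (Store x i a) s (1 + acost i + acost a)
            (s(x := (s x)(aval i s := aval a s)))"
| Seq: "exec c s t s' \<Longrightarrow> exec d s' t' s'' \<Longrightarrow> exec (Seq c d) s (t + t') s''"
| CondTrue: "bval b s \<Longrightarrow> exec c s t s' \<Longrightarrow> exec (Cond b c d) s (1 + bcost b + t) s'"
| CondFalse: "\<not> bval b s \<Longrightarrow> exec d s t s' \<Longrightarrow> exec (Cond b c d) s (1 + bcost b + t) s'"
| WhileFalse: "\<not> bval b s \<Longrightarrow> exec (While b c) s (1 + bcost b) s"
| WhileTrue: "bval b s \<Longrightarrow> exec c s t s' \<Longrightarrow> exec (While b c) s' t' s'' \<Longrightarrow>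
            exec (While b c) s (1 + bcost b + t + t') s''"

inductive_cases SkipE: "exec Skip s t s'"
inductive_cases StoreE: "exec (Store x i a) s t s'"
inductive_cases SeqE: "exec (Seq c d) s t s'"
inductive_cases CondE: "exec (Cond b c d) s t s'"
inductive_cases WhileE: "exec (While b c) s t s'"

lemma exec_deterministic:
  "exec c s t s' \<Longrightarrow> exec c s r s'' \<Longrightarrow> r = t \<and> s'' = s'"
proof (induction arbitrary: r s'' rule: exec.induct)
  case (Skip s)
  then show ?case by (auto elim: SkipE)
next
  case (Store x i a s)
  then show ?case by (auto elim: StoreE)
next
  case (Seq c s t s' d t' s2)
  from Seq.prems obtain r1 m r2 where "exec c s r1 m" "exec d m r2 s''" "r = r1 + r2"
    by (rule SeqE)
  with Seq.IH(1)[of r1 m] Seq.IH(2)[of r2 s''] show ?case by simp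
next
  case (CondTrue b s c t s' d)
  from CondTrue.prems CondTrue.hyps(1) obtain r1 where "exec c s r1 s''" "r = 1 + bcost b + r1"
    by (auto elim: CondE)
  with CondTrue.IH[of r1 s''] show ?case by simp
next
  case (CondFalse b s d t s' c)
  from CondFalse.prems CondFalse.hyps(1) obtain r1 where "exec d s r1 s''" "r = 1 + bcost b + r1"
    by (auto elim: CondE)
  with CondFalse.IH[of r1 s''] show ?case by simp
next
  case (WhileFalse b s c)
  from WhileFalse.prems WhileFalse.hyps show ?case by (auto elim: WhileE)
next
  case (WhileTrue b s c t s' t' s2)
  from WhileTrue.prems WhileTrue.hyps(1)
  obtain r1 m r2 where "exec c s r1 m" "exec (While b c) m r2 s''" "r = 1 + bcost b + r1 + r2"
    by (auto elim: WhileE)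
  with WhileTrue.IH(1)[of r1 m] WhileTrue.IH(2)[of r2 s''] show ?case by simp
qed

definition halts_within :: "com \<Rightarrow> mem \<Rightarrow> nat \<Rightarrow> (mem \<Rightarrow> bool) \<Rightarrow> bool" where
  "halts_within c s b Q \<longleftrightarrow> (\<exists>t s'. exec c s t s' \<and> t \<le> b \<and> Q s')"

section \<open>Input and output format\<close>

definition array :: "nat list \<Rightarrow> nat \<Rightarrow> nat" where
  "array xs i = (if i < length xs then xs ! i else 0)"

text \<open>The vertices are numbered \<open>0, \<dots>, n - 1\<close> by their position in an arbitrary enumeration \<open>ns\<close>,
  and \<open>adj ! i\<close> lists the neighbours of vertex \<open>i\<close> in arbitrary order. The adjacency lists are
  stored consecutively: the list of vertex \<open>i\<close> occupies the cells \<open>off[i], \<dots>, off[i+1] - 1\<close> of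
  the array \<open>adj\<close>. The ordering is stored as the sequence of its vertex numbers. All cells
  that are not part of the input are zero.\<close>

definition encodes_instance ::
    "mem \<Rightarrow> 'a set \<Rightarrow> 'a set set \<Rightarrow> 'a list \<Rightarrow> ('a \<Rightarrow> nat) \<Rightarrow> ('a \<Rightarrow> nat) \<Rightarrow> bool" where
  "encodes_instance s V E vs k u \<longleftrightarrow>
     (\<exists>ns adj ord.
        distinct ns \<and> set ns = V \<and>
        length adj = length ns \<and>
        (\<forall>i<length ns. distinct (adj ! i) \<and>
           set (adj ! i) = {j. j < length ns \<and> {ns ! i, ns ! j} \<in> E}) \<and>
        (\<forall>i\<in>set ord. i < length ns) \<and> map (\<lambda>i. ns ! i) ord = vs \<and>
        s = (\<lambda>_ _. 0)
          (''n'' := array [length ns],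
           ''off'' := array (map (\<lambda>i. length (concat (take i adj))) [0..<length ns + 1]),
           ''adj'' := array (concat adj),
           ''ord'' := array ord,
           ''k'' := array (map k ns),
           ''u'' := array (map u ns)))"

text \<open>An instance of GDF may have no feasible function; the program has to detect this.\<close>

definition gdf_output ::
    "'a set \<Rightarrow> 'a set set \<Rightarrow> ('a \<Rightarrow> nat) \<Rightarrow> ('a \<Rightarrow> nat) \<Rightarrow> mem \<Rightarrow> bool" where
  "gdf_output V E k u s \<longleftrightarrow>
     (if \<exists>f. gdf_feasible V E k u f
      then s ''feasible'' 0 = 1 \<and> is_gdf_minimum V E k u (s ''opt'' 0)
      else s ''feasible'' 0 = 0)"

definition gpf_output ::
    "'a set \<Rightarrow> 'a set set \<Rightarrow> ('a \<Rightarrow> nat) \<Rightarrow> ('a \<Rightarrow> nat) \<Rightarrow> mem \<Rightarrow> bool" where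
  "gpf_output V E k u s \<longleftrightarrow> is_gpf_maximum V E k u (s ''opt'' 0)"

end

theory Submission
  imports Defs
begin

text \<open>Sorted along a strong elimination ordering, the closed neighbourhood matrix is \<open>\<Gamma>\<close>-free.
  For such a matrix GPF is solved greedily: go through the vertices in order and give each of them
  the largest value that its upper bound and the remaining capacities in its closed neighbourhood
  allow. If a packing gives less to the current vertex, one unit can be moved there from a later
  vertex that lies in all tight constraints. The substitution \<open>f = u - g\<close> turns GDF into GPF with
  capacities \<open>u(N[v]) - k(v)\<close>, and GDF is feasible iff \<open>k(v) \<le> u(N[v])\<close> for all \<open>v\<close>. Both
  algorithms scan every adjacency list a constant number of times.\<close>

section \<open>Greedy packing\<close>

text \<open>The danger for a greedy packing is that several full rows block a raise of the current
  column, each needing a different later column to give way, so that one unit gained costs several.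
  \<Gamma>-freeness excludes this: the full row of least rank has a later column with positive
  value, and that column must occur in all other full rows as well.

  Rows and columns are indexed by the same vertices and the matrix is symmetric, so one ordering
  sorts both, and a condition on nested neighbourhoods can be read as one on rows or on columns.

  Only the optimal value is reported, so the packing itself is never stored. The recursion
  \<open>greedy\<close> carries the residual capacities as an argument, and these are exactly the
  contents of the array \<open>k\<close>, which the program overwrites in place. Choosing a value
  and charging it touch only one closed neighbourhood, hence the linear running time.\<close>

definition packing ::
    "('a \<Rightarrow> 'a set) \<Rightarrow> ('a \<Rightarrow> nat) \<Rightarrow> 'a set \<Rightarrow> ('a \<Rightarrow> nat) \<Rightarrow> 'a set \<Rightarrow> ('a \<Rightarrow> nat) \<Rightarrow> bool" where
  "packing N u R k X f \<longleftrightarrow> (\<forall>v\<in>X. f v \<le> u v) \<and> (\<forall>r\<in>R. sum f (N r \<inter> X) \<le> k r)"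

definition room :: "('a \<Rightarrow> 'a set) \<Rightarrow> ('a \<Rightarrow> nat) \<Rightarrow> ('a \<Rightarrow> nat) \<Rightarrow> 'a \<Rightarrow> nat" where
  "room N u k v = Min (insert (u v) (k ` N v))"

definition consume :: "('a \<Rightarrow> 'a set) \<Rightarrow> ('a \<Rightarrow> nat) \<Rightarrow> 'a \<Rightarrow> nat \<Rightarrow> 'a \<Rightarrow> nat" where
  "consume N k v m w = (if w \<in> N v then k w - m else k w)"

primrec greedy :: "('a \<Rightarrow> 'a set) \<Rightarrow> ('a \<Rightarrow> nat) \<Rightarrow> 'a list \<Rightarrow> ('a \<Rightarrow> nat) \<Rightarrow> nat" where
  "greedy N u [] k = 0"
| "greedy N u (v # vs) k = room N u k v + greedy N u vs (consume N k v (room N u k v))"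

text \<open>The last assumption says that the matrix of \<open>N\<close>, with rows and columns sorted by \<open>rank\<close>,
  has no submatrix with rows \<open>1 1\<close> and \<open>1 0\<close>.\<close>

locale gamma_free =
  fixes R :: "'a set" and N :: "'a \<Rightarrow> 'a set" and rank :: "'a \<Rightarrow> nat"
  assumes finite_R: "finite R"
    and N_subset: "v \<in> R \<Longrightarrow> N v \<subseteq> R"
    and N_sym: "v \<in> R \<Longrightarrow> w \<in> R \<Longrightarrow> w \<in> N v \<longleftrightarrow> v \<in> N w"
    and gamma: "r \<in> R \<Longrightarrow> r' \<in> R \<Longrightarrow> c \<in> R \<Longrightarrow> c' \<in> R \<Longrightarrow> rank r \<le> rank r' \<Longrightarrow>
      rank c < rank c' \<Longrightarrow> c \<in> N r \<Longrightarrow> c' \<in> N r \<Longrightarrow> c \<in> N r' \<Longrightarrow> c' \<in> N r'"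
begin

lemma finite_N: "v \<in> R \<Longrightarrow> finite (N v)"
  using N_subset finite_R finite_subset by blast

text \<open>By symmetry \<open>N v\<close> is also the set of rows that contain the column
  \<open>v\<close>, and these are the rows whose capacities limit its value.\<close>

lemma le_room_iff:
  assumes "v \<in> R"
  shows "x \<le> room N u k v \<longleftrightarrow> x \<le> u v \<and> (\<forall>r\<in>R. v \<in> N r \<longrightarrow> x \<le> k r)"
proof -
  have "x \<le> room N u k v \<longleftrightarrow> x \<le> u v \<and> (\<forall>r\<in>N v. x \<le> k r)"
    using finite_N[OF assms] by (simp add: room_def)
  also have "(\<forall>r\<in>N v. x \<le> k r) \<longleftrightarrow> (\<forall>r\<in>R. v \<in> N r \<longrightarrow> x \<le> k r)"
    using N_sym N_subset assms by blast
  finally show ?thesis .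
qed

lemma sum_row_insert:
  assumes "r \<in> R" "v \<notin> X"
  shows "sum f (N r \<inter> insert v X) = (if v \<in> N r then f v else 0) + sum f (N r \<inter> X)"
  using assms finite_N[of r] by (simp add: Int_insert_right)

text \<open>Fixing one column and charging its value to the rows leaves a problem of the same kind
  on the remaining columns. All rows stay, since the constraint of a handled vertex still binds
  later ones. The bound by \<open>room\<close> makes the truncated subtraction in
  \<open>consume\<close> exact.\<close>

lemma packing_insert:
  assumes "v \<in> R" "v \<notin> X" "f v \<le> room N u k v"
  shows "packing N u R k (insert v X) f \<longleftrightarrow> packing N u R (consume N k v (f v)) X f"
proof -
  have *: "f v \<le> u v" "\<And>r. r \<in> R \<Longrightarrow> v \<in> N r \<Longrightarrow> f v \<le> k r"
    using assms le_room_iff[of v "f v" u k] by auto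
  have "sum f (N r \<inter> insert v X) \<le> k r \<longleftrightarrow> sum f (N r \<inter> X) \<le> consume N k v (f v) r" if "r \<in> R" for r
    using sum_row_insert[OF that \<open>v \<notin> X\<close>, of f] N_sym[OF that \<open>v \<in> R\<close>] *(2)[OF that]
    by (auto simp: consume_def)
  then show ?thesis
    using * by (simp add: packing_def)
qed

lemma packing_cong:
  assumes "\<And>v. v \<in> X \<Longrightarrow> f v = g v"
  shows "packing N u R k X f \<longleftrightarrow> packing N u R k X g"
proof -
  have "sum f (N r \<inter> X) = sum g (N r \<inter> X)" for r
    by (rule sum.cong) (auto simp: assms)
  then show ?thesis
    using assms by (simp add: packing_def)
qed

lemma greedy_attained:
  "distinct xs \<Longrightarrow> set xs \<subseteq> R \<Longrightarrow> \<exists>f. packing N u R k (set xs) f \<and> sum f (set xs) = greedy N u xs k"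
proof (induction xs arbitrary: k)
  case Nil
  then show ?case by (simp add: packing_def)
next
  case (Cons v xs)
  let ?m = "room N u k v"
  obtain f where f: "packing N u R (consume N k v ?m) (set xs) f"
    "sum f (set xs) = greedy N u xs (consume N k v ?m)"
    using Cons by (metis distinct.simps(2) insert_subset list.simps(15))
  have v: "v \<notin> set xs" "v \<in> R"
    using Cons.prems by auto
  let ?f = "f(v := ?m)"
  have "packing N u R (consume N k v ?m) (set xs) ?f"
    using f(1) v(1) by (subst packing_cong[of "set xs" _ f]) auto
  then have "packing N u R k (set (v # xs)) ?f"
    using packing_insert[of v "set xs" ?f u k] v by simp
  moreover have "sum ?f (set xs) = sum f (set xs)"
    by (rule sum.cong) (use v in auto)
  then have "sum ?f (set (v # xs)) = greedy N u (v # xs) k"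
    using f(2) v by simp
  ultimately show ?case by blast
qed

text \<open>A raise of \<open>f v\<close> within \<open>room\<close> is blocked only by the rows of
  \<open>T\<close>, which contain \<open>v\<close> and are full. A unit withdrawn from a single
  later column frees all of them at once, so the total does not drop.\<close>

lemma packing_exchange:
  assumes pack: "packing N u R k (insert v X) f" and less: "f v < room N u k v"
    and v: "v \<in> R" "v \<notin> X" and X: "X \<subseteq> R" "\<And>w. w \<in> X \<Longrightarrow> rank v < rank w"
  shows "\<exists>g. packing N u R k (insert v X) g \<and> g v = Suc (f v) \<and>
    sum f (insert v X) \<le> sum g (insert v X)"
proof -
  have finX: "finite X"
    using X finite_R finite_subset by blast
  have fu: "\<And>w. w \<in> X \<Longrightarrow> f w \<le> u w" and Suc_u: "Suc (f v) \<le> u v"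
    and Suc_k: "\<And>r. r \<in> R \<Longrightarrow> v \<in> N r \<Longrightarrow> Suc (f v) \<le> k r"
    using pack less le_room_iff[OF v(1), of "Suc (f v)" u k] by (auto simp: packing_def)
  have fk: "(if v \<in> N r then f v else 0) + sum f (N r \<inter> X) \<le> k r" if "r \<in> R" for r
    using pack sum_row_insert[OF that v(2), of f] that by (metis packing_def)
  let ?f = "f(v := Suc (f v))"
  have upd: "sum ?f Y = sum f Y" if "Y \<subseteq> X" for Y
    by (rule sum.cong) (use v that in auto)
  define T where "T = {r \<in> R. v \<in> N r \<and> f v + sum f (N r \<inter> X) = k r}"
  show ?thesis
  proof (cases "T = {}")
    case True
    have "(if v \<in> N r then Suc (f v) else 0) + sum f (N r \<inter> X) \<le> k r" if "r \<in> R" for r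
      using fk[OF that] True that by (force simp: T_def Suc_le_eq le_less)
    then have "sum ?f (N r \<inter> insert v X) \<le> k r" if "r \<in> R" for r
      using sum_row_insert[OF that v(2), of ?f] upd[of "N r \<inter> X"] that by fastforce
    then have "packing N u R k (insert v X) ?f"
      using fu Suc_u by (simp add: packing_def)
    moreover have "sum f (insert v X) \<le> sum ?f (insert v X)"
      using v finX upd[of X] by simp
    ultimately show ?thesis by (intro exI[of _ ?f]) simp
  next
    case False
    \<comment> \<open>One unit moves to \<open>v\<close> from a later vertex \<open>l\<close> in the lowest tight row \<open>r0\<close>; as the matrix
      is \<open>\<Gamma>\<close>-free, every tight row contains \<open>l\<close>.\<close>
    define r0 where "r0 = arg_min_on rank T"
    have finT: "finite T"
      using finite_R by (simp add: T_def)
    have r0: "r0 \<in> T" "\<And>r. r \<in> T \<Longrightarrow> rank r0 \<le> rank r"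
      using arg_min_if_finite[OF finT False, of rank] by (auto simp: r0_def not_less)
    then have r0': "r0 \<in> R" "v \<in> N r0" "f v + sum f (N r0 \<inter> X) = k r0"
      by (auto simp: T_def)
    then have "sum f (N r0 \<inter> X) \<noteq> 0"
      using Suc_k[of r0] by auto
    then obtain l where l: "l \<in> N r0" "l \<in> X" "f l \<noteq> 0"
      by (metis IntE sum.neutral)
    have lT: "l \<in> N r" if "r \<in> T" for r
      using gamma[of r0 r v l] that r0 r0' l v X by (auto simp: T_def)
    let ?g = "?f(l := f l - 1)"
    have lv: "l \<noteq> v" using l v by auto
    have dec: "sum ?g Y + (if l \<in> Y then 1 else 0) = sum f Y" if "Y \<subseteq> X" for Y
    proof (cases "l \<in> Y")
      case True
      have "finite Y" using that finX finite_subset by blast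
      then have "sum ?g Y = f l - 1 + sum ?g (Y - {l})" "sum f Y = f l + sum f (Y - {l})"
        using True by (simp_all add: sum.remove)
      moreover have "sum ?g (Y - {l}) = sum f (Y - {l})"
        by (rule sum.cong) (use v that in auto)
      ultimately show ?thesis using True l by simp
    next
      case False
      have "sum ?g Y = sum f Y"
        by (rule sum.cong) (use False v that in auto)
      then show ?thesis using False by simp
    qed
    \<comment> \<open>Rows of \<open>T\<close> gain a unit at \<open>v\<close> and lose one at
      \<open>l\<close>; the other rows through \<open>v\<close> have slack for the new unit; rows
      avoiding \<open>v\<close> gain nothing.\<close>
    have "(if v \<in> N r then Suc (f v) else 0) + sum ?g (N r \<inter> X) \<le> k r" if "r \<in> R" for r
    proof (cases "r \<in> T")
      case True
      then show ?thesis using fk[OF that] dec[of "N r \<inter> X"] lT[OF True] l by auto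
    next
      case False
      then have "(if v \<in> N r then Suc (f v) else 0) + sum f (N r \<inter> X) \<le> k r"
        using fk[OF that] that by (force simp: T_def Suc_le_eq le_less)
      then show ?thesis using dec[of "N r \<inter> X"] by (auto split: if_splits)
    qed
    moreover have "?g w \<le> u w" if "w \<in> insert v X" for w
      using fu[of w] fu[OF l(2)] Suc_u that lv by auto
    moreover have "?g v = Suc (f v)"
      using lv by simp
    ultimately have "packing N u R k (insert v X) ?g"
      using sum_row_insert[OF _ v(2), of _ ?g] unfolding packing_def by metis
    moreover have "sum f (insert v X) \<le> sum ?g (insert v X)"
      using v finX dec[of X] l lv by simp
    ultimately show ?thesis using lv by (intro exI[of _ ?g]) simp
  qed
qed

text \<open>The inner induction is on the gap between \<open>g v\<close> and the greedy choice: each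
  exchange closes it by one unit without loss. At gap 0 the packing starts like the greedy one, and
  the outer hypothesis handles the remaining columns.\<close>

lemma greedy_optimal:
  "sorted_wrt (\<lambda>x y. rank x < rank y) xs \<Longrightarrow> set xs \<subseteq> R \<Longrightarrow> packing N u R k (set xs) f \<Longrightarrow>
    sum f (set xs) \<le> greedy N u xs k"
proof (induction xs arbitrary: k f)
  case Nil
  then show ?case by simp
next
  case (Cons v xs)
  let ?m = "room N u k v"
  have v: "v \<in> R" "v \<notin> set xs" "set xs \<subseteq> R" "\<And>w. w \<in> set xs \<Longrightarrow> rank v < rank w"
    using Cons.prems by auto
  \<comment> \<open>No packing exceeds the greedy choice at \<open>v\<close>, so a truncated
    difference \<open>?m - g v\<close> of 0 really means equality.\<close>
  have le: "g v \<le> ?m" if "packing N u R k (insert v (set xs)) g" for g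
  proof -
    have "g v \<le> k r" if "r \<in> R" "v \<in> N r" for r
      using \<open>packing N u R k (insert v (set xs)) g\<close> sum_row_insert[OF that(1) v(2), of g] that
      by (force simp: packing_def)
    then show ?thesis
      using that le_room_iff[OF v(1)] by (auto simp: packing_def)
  qed
  have "sum g (insert v (set xs)) \<le> greedy N u (v # xs) k"
    if "packing N u R k (insert v (set xs)) g" for g
    using that
  proof (induction "?m - g v" arbitrary: g)
    case 0
    then have "g v = ?m" using le[of g] by simp
    then have "sum g (set xs) \<le> greedy N u xs (consume N k v ?m)"
      using Cons.IH[of "consume N k v ?m" g] Cons.prems packing_insert[of v "set xs" g u k] v 0
      by simp
    then show ?case using v \<open>g v = ?m\<close> by simp
  next
    case (Suc d)
    then have "g v < ?m" by simp
    from packing_exchange[OF Suc.prems this v]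
    obtain h where "packing N u R k (insert v (set xs)) h" "h v = Suc (g v)"
      "sum g (insert v (set xs)) \<le> sum h (insert v (set xs))"
      by auto
    moreover from this have "sum h (insert v (set xs)) \<le> greedy N u (v # xs) k"
      using Suc.hyps(2) by (intro Suc.hyps(1)) auto
    ultimately show ?case by linarith
  qed
  with Cons.prems(3) show ?case by simp
qed

end

text \<open>The program computes with vertex numbers, the optimality proof with vertices; the greedy
  value is invariant under such a renaming. Capacities need to agree on \<open>I\<close> only,
  because \<open>M i \<subseteq> I\<close> keeps every access inside \<open>I\<close>.\<close>

lemma greedy_map:
  assumes "\<And>i. i \<in> I \<Longrightarrow> M i \<subseteq> I \<and> N (g i) = g ` M i \<and> u' i = u (g i)" "inj_on g I"
  shows "set xs \<subseteq> I \<Longrightarrow> (\<And>i. i \<in> I \<Longrightarrow> k' i = k (g i)) \<Longrightarrow>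
    greedy M u' xs k' = greedy N u (map g xs) k"
proof (induction xs arbitrary: k k')
  case Nil
  then show ?case by simp
next
  case (Cons v xs)
  have v: "v \<in> I" using Cons.prems by simp
  have "k' ` M v = k ` N (g v)"
    using assms(1)[OF v] Cons.prems(2) by (force simp: image_image)
  then have room: "room M u' k' v = room N u k (g v)"
    using assms(1)[OF v] by (simp add: room_def)
  have "consume M k' v m i = consume N k (g v) m (g i)" if "i \<in> I" for i m
    using assms(1)[OF v] Cons.prems(2)[OF that] that inj_on_image_mem_iff[OF assms(2), of i "M v"]
    by (simp add: consume_def)
  then have "greedy M u' xs (consume M k' v m) = greedy N u (map g xs) (consume N k (g v) m)" for m
    using Cons by simp
  then show ?case using room by simp
qed

section \<open>Strong elimination orderings\<close>

lemma closed_nbhd_induced: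
  assumes "x \<in> W" "W \<subseteq> V"
  shows "closed_nbhd W (induced_edges E W) x = closed_nbhd V E x \<inter> W"
  using assms by (auto simp: closed_nbhd_def induced_edges_def)

lemma closed_nbhd_sym: "v \<in> V \<Longrightarrow> w \<in> V \<Longrightarrow> w \<in> closed_nbhd V E v \<longleftrightarrow> v \<in> closed_nbhd V E w"
  by (auto simp: closed_nbhd_def insert_commute)

text \<open>Among positions from \<open>i\<close> on, adjacency in \<open>G\<^sub>i\<close> is
  adjacency in the whole graph. So the inclusion of neighbourhoods demanded at step \<open>i\<close>
  can be used in the whole graph for every \<open>l\<close> with \<open>i \<le> l\<close>.\<close>

lemma strong_elimination_nbhd:
  assumes seo: "strong_elimination_ordering V E vs"
    and ij: "i \<le> j" "j < k" "k < length vs"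
    and "vs ! j \<in> closed_nbhd V E (vs ! i)" "vs ! k \<in> closed_nbhd V E (vs ! i)"
    and "i \<le> l" "l < length vs" "vs ! l \<in> closed_nbhd V E (vs ! j)"
  shows "vs ! l \<in> closed_nbhd V E (vs ! k)"
proof -
  define W where "W = set (drop i vs)"
  have W1: "W \<subseteq> V"
    using seo by (auto simp: W_def strong_elimination_ordering_def dest: in_set_dropD)
  have W2: "vs ! j \<in> W" if "i \<le> j" "j < length vs" for j
    using nth_mem[of "j - i" "drop i vs"] that by (simp add: W_def)
  have i: "i < length vs" using ij by simp
  have "closed_nbhd W (induced_edges E W) (vs ! j) \<subseteq> closed_nbhd W (induced_edges E W) (vs ! k)"
    if "{vs ! j, vs ! k} \<subseteq> closed_nbhd W (induced_edges E W) (vs ! i)"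
    using seo i ij that unfolding strong_elimination_ordering_def Let_def W_def
    by (meson less_imp_le)
  then show ?thesis
    using assms W2 closed_nbhd_induced[OF W2 W1] by auto
qed

text \<open>The earliest of the four positions is \<open>a\<close> or \<open>c\<close>. If it is
  \<open>a\<close>, then \<open>c\<close> and \<open>d\<close> are neighbours of \<open>a\<close>
  with nested neighbourhoods, and \<open>b\<close> passes from that of \<open>c\<close> to that of
  \<open>d\<close>. If it is \<open>c\<close>, then \<open>a\<close> and \<open>b\<close> are nested
  in the same way, and \<open>d\<close> passes from \<open>a\<close> to \<open>b\<close>.\<close>

lemma strong_elimination_gamma:
  assumes seo: "strong_elimination_ordering V E vs"
    and less: "a < b" "b < length vs" "c < d" "d < length vs"
    and nbhd: "vs ! c \<in> closed_nbhd V E (vs ! a)" "vs ! d \<in> closed_nbhd V E (vs ! a)"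
      "vs ! c \<in> closed_nbhd V E (vs ! b)"
  shows "vs ! d \<in> closed_nbhd V E (vs ! b)"
proof -
  have "\<And>i. i < length vs \<Longrightarrow> vs ! i \<in> V"
    using seo by (auto simp: strong_elimination_ordering_def)
  then have sym: "vs ! i \<in> closed_nbhd V E (vs ! j) \<longleftrightarrow> vs ! j \<in> closed_nbhd V E (vs ! i)"
    if "i < length vs" "j < length vs" for i j
    using that closed_nbhd_sym by metis
  show ?thesis
  proof (cases "a \<le> c")
    case True
    then show ?thesis
      using strong_elimination_nbhd[OF seo, of a c d b] less nbhd sym[of b c] sym[of b d] by simp
  next
    case False
    then show ?thesis
      using strong_elimination_nbhd[OF seo, of c a b d] less nbhd sym[of a c] sym[of b c] by simp
  qed
qed

lemma greedy_gpf_maximum: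
  assumes "simple_graph V E" and seo: "strong_elimination_ordering V E vs"
  shows "is_gpf_maximum V E k u (greedy (closed_nbhd V E) u vs k)"
proof -
  define rank where "rank = the_inv_into {..<length vs} (nth vs)"
  have vs: "distinct vs" "set vs = V"
    using seo by (auto simp: strong_elimination_ordering_def)
  have rank: "rank (vs ! i) = i" if "i < length vs" for i
    using that vs by (simp add: rank_def the_inv_into_f_f inj_on_nth)
  interpret gamma_free V "closed_nbhd V E" rank
  proof
    show "finite V" using assms(1) by (simp add: simple_graph_def)
    show "closed_nbhd V E v \<subseteq> V" for v by (auto simp: closed_nbhd_def)
    show "v \<in> V \<Longrightarrow> w \<in> V \<Longrightarrow> w \<in> closed_nbhd V E v \<longleftrightarrow> v \<in> closed_nbhd V E w" for v w
      by (rule closed_nbhd_sym)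
    fix r r' c c'
    assume *: "r \<in> V" "r' \<in> V" "c \<in> V" "c' \<in> V" "rank r \<le> rank r'" "rank c < rank c'"
      "c \<in> closed_nbhd V E r" "c' \<in> closed_nbhd V E r" "c \<in> closed_nbhd V E r'"
    then obtain a b i j where "r = vs ! a" "r' = vs ! b" "c = vs ! i" "c' = vs ! j"
      "a < length vs" "b < length vs" "i < length vs" "j < length vs"
      using vs(2) by (metis in_set_conv_nth)
    \<comment> \<open>\<open>rank r \<le> rank r'\<close> leaves two rows in strict order or one and
      the same row; in the latter case the claim is immediate.\<close>
    with * rank strong_elimination_gamma[OF seo, of a b i j] show "c' \<in> closed_nbhd V E r'"
      by (cases "a = b") auto
  qed
  have feasible: "gpf_feasible V E k u f \<longleftrightarrow> packing (closed_nbhd V E) u V k (set vs) f" for f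
  proof -
    have "closed_nbhd V E r \<inter> V = closed_nbhd V E r" for r
      by (auto simp: closed_nbhd_def)
    then show ?thesis by (auto simp: gpf_feasible_def packing_def vs)
  qed
  have "sorted_wrt (\<lambda>x y. rank x < rank y) vs"
    using rank by (simp add: sorted_wrt_iff_nth_less)
  then show ?thesis
    unfolding is_gpf_maximum_def feasible
    using greedy_attained[of vs u k] greedy_optimal[of vs u k] vs by simp
qed

text \<open>Complementation \<open>f \<mapsto> u - f\<close> is an involution on the functions
  bounded by \<open>u\<close> and exchanges lower with upper bounds on the sums. The assumption
  \<open>le\<close> keeps the new capacities from being truncated, which is what the direction from
  packing to domination relies on.\<close>

lemma gdf_minimum_from_gpf_maximum:
  assumes le: "\<And>v. v \<in> V \<Longrightarrow> k v \<le> sum u (closed_nbhd V E v)"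
    and max: "is_gpf_maximum V E (\<lambda>v. sum u (closed_nbhd V E v) - k v) u m"
  shows "is_gdf_minimum V E k u (sum u V - m)"
proof -
  let ?k = "\<lambda>v. sum u (closed_nbhd V E v) - k v"
  have N: "closed_nbhd V E v \<subseteq> V" for v
    by (auto simp: closed_nbhd_def)
  have comp: "sum (\<lambda>w. u w - f w) X = sum u X - sum f X" "sum f X \<le> sum u X"
    if "\<forall>v\<in>V. f v \<le> u v" "X \<subseteq> V" for f X
    using that by (auto intro!: sum_subtractf_nat sum_mono)
  have to_gdf: "gdf_feasible V E k u (\<lambda>w. u w - f w)" if f: "gpf_feasible V E ?k u f" for f
  proof -
    have fu: "\<forall>v\<in>V. f v \<le> u v" using f by (auto simp: gpf_feasible_def)
    have "k v \<le> sum (\<lambda>w. u w - f w) (closed_nbhd V E v)" if "v \<in> V" for v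
    proof -
      have "sum f (closed_nbhd V E v) \<le> ?k v" using f that by (auto simp: gpf_feasible_def)
      then show ?thesis using comp[OF fu N] le[OF that] by simp
    qed
    then show ?thesis by (simp add: gdf_feasible_def)
  qed
  have to_gpf: "gpf_feasible V E ?k u (\<lambda>w. u w - f w)" if f: "gdf_feasible V E k u f" for f
  proof -
    have fu: "\<forall>v\<in>V. f v \<le> u v" using f by (auto simp: gdf_feasible_def)
    then show ?thesis
      using f comp[OF fu N] by (auto simp: gpf_feasible_def gdf_feasible_def intro: diff_le_mono2)
  qed
  obtain g where g: "gpf_feasible V E ?k u g" "sum g V = m"
    using max by (auto simp: is_gpf_maximum_def)
  have "sum (\<lambda>w. u w - g w) V = sum u V - m"
    using comp(1)[of g V] g by (simp add: gpf_feasible_def)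
  moreover have "sum u V - m \<le> sum f V" if f: "gdf_feasible V E k u f" for f
  proof -
    have "sum u V - sum f V \<le> m"
      using max to_gpf[OF f] comp(1)[of f V] f
      by (auto simp: is_gpf_maximum_def gdf_feasible_def)
    then show ?thesis by simp
  qed
  ultimately show ?thesis
    unfolding is_gdf_minimum_def using to_gdf[OF g(1)] by blast
qed

text \<open>The function \<open>u\<close> is the pointwise largest candidate, so some candidate
  meets the lower bounds iff \<open>u\<close> does.\<close>

lemma gdf_feasible_iff:
  "(\<exists>f. gdf_feasible V E k u f) \<longleftrightarrow> (\<forall>v\<in>V. k v \<le> sum u (closed_nbhd V E v))"
proof
  assume "\<exists>f. gdf_feasible V E k u f"
  then obtain f where f: "gdf_feasible V E k u f" ..
  have "sum f (closed_nbhd V E v) \<le> sum u (closed_nbhd V E v)" for v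
    using f by (intro sum_mono) (auto simp: gdf_feasible_def closed_nbhd_def)
  with f show "\<forall>v\<in>V. k v \<le> sum u (closed_nbhd V E v)"
    unfolding gdf_feasible_def using le_trans by blast
next
  assume "\<forall>v\<in>V. k v \<le> sum u (closed_nbhd V E v)"
  then show "\<exists>f. gdf_feasible V E k u f"
    by (intro exI[of _ u]) (simp add: gdf_feasible_def)
qed


section \<open>Reasoning about programs\<close>

text \<open>A weakest precondition for total correctness whose postcondition also sees the running
  time. The rules for loop-free code are equations, so the simplifier can execute it
  symbolically.\<close>

definition runs :: "com \<Rightarrow> mem \<Rightarrow> (nat \<Rightarrow> mem \<Rightarrow> bool) \<Rightarrow> bool" where
  "runs c s Q \<longleftrightarrow> (\<exists>t s'. exec c s t s' \<and> Q t s')"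

lemma halts_within_runs: "halts_within c s b Q \<longleftrightarrow> runs c s (\<lambda>t s'. t \<le> b \<and> Q s')"
  by (simp add: halts_within_def runs_def)

lemma runs_mono: "runs c s Q \<Longrightarrow> (\<And>t s'. Q t s' \<Longrightarrow> Q' t s') \<Longrightarrow> runs c s Q'"
  by (auto simp: runs_def)

lemma runs_Skip: "runs Skip s Q \<longleftrightarrow> Q 1 s"
  unfolding runs_def by (auto elim: SkipE intro: exec.Skip[simplified])

lemma runs_Store:
  "runs (Store x i a) s Q \<longleftrightarrow> Q (1 + acost i + acost a) (s(x := (s x)(aval i s := aval a s)))"
  unfolding runs_def by (metis StoreE exec.Store)

lemma runs_Seq: "runs (Seq c d) s Q \<longleftrightarrow> runs c s (\<lambda>t s'. runs d s' (\<lambda>t'. Q (t + t')))"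
  unfolding runs_def by (metis SeqE exec.Seq)

lemma runs_Cond:
  "runs (Cond b c d) s Q \<longleftrightarrow> runs (if bval b s then c else d) s (\<lambda>t. Q (1 + bcost b + t))"
  unfolding runs_def
  by (cases "bval b s") (simp_all, (metis CondE exec.CondTrue exec.CondFalse plus_1_eq_Suc add_Suc)+)

lemmas runs_simps = runs_Skip runs_Store runs_Seq runs_Cond

text \<open>The budget \<open>B j\<close> may differ between iterations: an outer iteration costs as
  much as the degree of its vertex, and only the sum over all iterations is linear. The factor
  \<open>Suc m\<close> counts the failing last test.\<close>

lemma runs_While:
  assumes "I 0 s"
    and body: "\<And>j s. j < m \<Longrightarrow> I j s \<Longrightarrow> bval b s \<and> runs c s (\<lambda>t s'. t \<le> B j \<and> I (Suc j) s')"
    and exit: "\<And>s. I m s \<Longrightarrow> \<not> bval b s"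
  shows "runs (While b c) s (\<lambda>t s'. t \<le> (\<Sum>j<m. B j) + Suc m * (1 + bcost b) \<and> I m s')"
proof -
  have "I j s \<Longrightarrow> runs (While b c) s
      (\<lambda>t s'. t \<le> (\<Sum>i\<in>{j..<m}. B i) + Suc (m - j) * (1 + bcost b) \<and> I m s')"
    if "j \<le> m" for j s
    using that
  proof (induction j arbitrary: s rule: inc_induct)
    case base
    then show ?case
      unfolding runs_def using exit exec.WhileFalse
      by (intro exI[of _ "1 + bcost b"] exI[of _ s]) (auto simp del: One_nat_def)
  next
    case (step j)
    from body[OF \<open>j < m\<close> step.prems] obtain t s' where
      1: "bval b s" "exec c s t s'" "t \<le> B j" "I (Suc j) s'"
      by (auto simp: runs_def)
    from step.IH[OF 1(4)] obtain t' s'' where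
      2: "exec (While b c) s' t' s''" "I m s''"
        "t' \<le> (\<Sum>i\<in>{Suc j..<m}. B i) + Suc (m - Suc j) * (1 + bcost b)"
      by (auto simp: runs_def)
    have "(\<Sum>i\<in>{j..<m}. B i) = B j + (\<Sum>i\<in>{Suc j..<m}. B i)"
      using \<open>j < m\<close> by (simp add: sum.atLeast_Suc_lessThan)
    moreover have "m - j = Suc (m - Suc j)"
      using \<open>j < m\<close> by simp
    ultimately have "1 + bcost b + t + t' \<le> (\<Sum>i\<in>{j..<m}. B i) + Suc (m - j) * (1 + bcost b)"
      using 1(3) 2(3) by simp
    with exec.WhileTrue[OF 1(1,2) 2(1)] 2(2) show ?case
      unfolding runs_def by blast
  qed
  from this[of 0 s] assms(1) show ?thesis
    by (simp add: atLeast0LessThan)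
qed

section \<open>The programs\<close>

abbreviation var :: "string \<Rightarrow> aexp" where
  "var x \<equiv> Load x (Const 0)"

abbreviation set_var :: "string \<Rightarrow> aexp \<Rightarrow> com" where
  "set_var x a \<equiv> Store x (Const 0) a"

definition for_adj :: "com \<Rightarrow> com" where
  "for_adj c = Seq (set_var ''p'' (Load ''off'' (var ''v'')))
     (While (Less (var ''p'') (Load ''off'' (Add (var ''v'') (Const 1))))
       (Seq c (set_var ''p'' (Add (var ''p'') (Const 1)))))"

definition min_com :: com where
  "min_com = Cond (Less (Load ''k'' (Load ''adj'' (var ''p''))) (var ''m''))
     (set_var ''m'' (Load ''k'' (Load ''adj'' (var ''p'')))) Skip"

definition consume_com :: com where
  "consume_com = Store ''k'' (Load ''adj'' (var ''p''))
     (Sub (Load ''k'' (Load ''adj'' (var ''p''))) (var ''m''))"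

definition sum_com :: com where
  "sum_com = set_var ''m'' (Add (var ''m'') (Load ''u'' (Load ''adj'' (var ''p''))))"

text \<open>An adjacency list omits its own vertex, so the entry of \<open>v\<close> is treated
  apart from both scans.\<close>

definition greedy_step :: com where
  "greedy_step =
     Seq (set_var ''v'' (Load ''ord'' (var ''i'')))
    (Seq (set_var ''m'' (Load ''u'' (var ''v'')))
    (Seq (Cond (Less (Load ''k'' (var ''v'')) (var ''m'')) (set_var ''m'' (Load ''k'' (var ''v''))) Skip)
    (Seq (for_adj min_com)
    (Seq (set_var ''opt'' (Add (var ''opt'') (var ''m'')))
    (Seq (Store ''k'' (var ''v'') (Sub (Load ''k'' (var ''v'')) (var ''m'')))
    (Seq (for_adj consume_com)
         (set_var ''i'' (Add (var ''i'') (Const 1)))))))))"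

definition gpf_com :: com where
  "gpf_com = While (Less (var ''i'') (var ''n'')) greedy_step"

text \<open>The scan reads \<open>u\<close> only, so overwriting \<open>k\<close> in place does not
  disturb later vertices. The cell \<open>tot\<close> collects the sum of \<open>u\<close> over all
  vertices, from which the packing optimum is subtracted at the end.\<close>

definition complement_step :: com where
  "complement_step =
     Seq (set_var ''m'' (Load ''u'' (var ''v'')))
    (Seq (set_var ''tot'' (Add (var ''tot'') (var ''m'')))
    (Seq (for_adj sum_com)
    (Seq (Cond (Less (var ''m'') (Load ''k'' (var ''v''))) (set_var ''feasible'' (Const 0)) Skip)
    (Seq (Store ''k'' (var ''v'') (Sub (var ''m'') (Load ''k'' (var ''v''))))
         (set_var ''v'' (Add (var ''v'') (Const 1)))))))"

definition gdf_com :: com where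
  "gdf_com =
     Seq (set_var ''feasible'' (Const 1))
    (Seq (While (Less (var ''v'') (var ''n'')) complement_step)
    (Seq gpf_com
         (set_var ''opt'' (Sub (var ''tot'') (var ''opt'')))))"

text \<open>The read-only part of the memory, hence an invariant of every loop; \<open>k\<close> is
  left out because it is overwritten.\<close>

definition graph_input :: "nat list list \<Rightarrow> (nat \<Rightarrow> nat) \<Rightarrow> nat list \<Rightarrow> mem \<Rightarrow> bool" where
  "graph_input A U xs s \<longleftrightarrow>
     s ''n'' 0 = length A \<and> (\<forall>i\<le>length A. s ''off'' i = length (concat (take i A))) \<and>
     s ''adj'' = array (concat A) \<and> s ''u'' = U \<and> s ''ord'' = array xs"

section \<open>Scans of a single adjacency list\<close>

lemma graph_input_upd:
  "x \<notin> {''n'', ''off'', ''adj'', ''u'', ''ord''} \<Longrightarrow>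
    graph_input A U xs (s(x := y)) \<longleftrightarrow> graph_input A U xs s"
  by (auto simp: graph_input_def)

lemma array_concat:
  assumes "i < length A" "j < length (A ! i)"
  shows "array (concat A) (length (concat (take i A)) + j) = A ! i ! j"
proof -
  have "concat A = concat (take i A) @ A ! i @ concat (drop (Suc i) A)"
    using id_take_nth_drop[OF assms(1)] by (metis concat.simps(2) concat_append)
  then show ?thesis
    using assms(2) by (simp add: array_def nth_append)
qed

text \<open>\<open>J j\<close> describes the memory after \<open>j\<close> entries. An iteration
  costs the body plus 6 steps for advancing \<open>p\<close> and 9 for the test; the initial
  assignment and the failing test together cost 14.\<close>

lemma for_adj_runs:
  assumes v: "v < length A"
    and J: "J 0 s" "\<And>j s. J j s \<Longrightarrow> graph_input A U xs s \<and> s ''v'' 0 = v"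
      "\<And>j s x. J j s \<Longrightarrow> J j (s(''p'' := x))"
    and body: "\<And>j s. j < length (A ! v) \<Longrightarrow> J j s \<Longrightarrow> s ''adj'' (s ''p'' 0) = A ! v ! j \<Longrightarrow>
      runs c s (\<lambda>t s'. t \<le> B \<and> J (Suc j) s' \<and> s' ''p'' = s ''p'')"
  shows "runs (for_adj c) s (\<lambda>t s'. t \<le> length (A ! v) * (B + 15) + 15 \<and> J (length (A ! v)) s')"
proof -
  let ?lo = "length (concat (take v A))" and ?d = "length (A ! v)"
  define I where "I j s \<longleftrightarrow> J j s \<and> s ''p'' 0 = ?lo + j" for j s
  let ?b = "Less (var ''p'') (Load ''off'' (Add (var ''v'') (Const 1)))"
  let ?c = "Seq c (set_var ''p'' (Add (var ''p'') (Const 1)))"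
  have off: "s ''off'' v = ?lo" "s ''off'' (Suc v) = ?lo + ?d" "s ''adj'' = array (concat A)"
    if "J j s" for s j
    using J(2)[OF that] v by (auto simp: graph_input_def take_Suc_conv_app_nth)
  let ?s = "s(''p'' := (s ''p'')(0 := ?lo))"
  have "runs (While ?b ?c) ?s
      (\<lambda>t s'. t \<le> (\<Sum>j<?d. B + 6) + Suc ?d * (1 + bcost ?b) \<and> I ?d s')"
  proof (rule runs_While)
    show "I 0 ?s" using J(1,3) by (simp add: I_def)
  next
    fix j s assume j: "j < ?d" and I: "I j s"
    then have "runs c s (\<lambda>t s'. t \<le> B \<and> J (Suc j) s' \<and> s' ''p'' = s ''p'')"
      using off[of j s] array_concat[OF v j] by (intro body) (auto simp: I_def)
    then have "runs ?c s (\<lambda>t s'. t \<le> B + 6 \<and> I (Suc j) s')"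
      unfolding runs_Seq
    proof (rule runs_mono)
      fix t s' assume "t \<le> B \<and> J (Suc j) s' \<and> s' ''p'' = s ''p''"
      then show "runs (set_var ''p'' (Add (var ''p'') (Const 1))) s'
          (\<lambda>t' s''. t + t' \<le> B + 6 \<and> I (Suc j) s'')"
        using I J(3) by (simp add: runs_Store I_def)
    qed
    then show "bval ?b s \<and> runs ?c s (\<lambda>t s'. t \<le> B + 6 \<and> I (Suc j) s')"
      using I j off[of j s] J(2)[of j s] by (simp add: I_def)
  next
    fix s assume "I ?d s"
    then show "\<not> bval ?b s"
      using off[of ?d s] J(2)[of ?d s] by (simp add: I_def)
  qed
  then show ?thesis
    unfolding for_adj_def runs_Seq runs_Store
    using off[OF J(1)] J(2)[OF J(1)]
    by (auto simp: I_def algebra_simps elim!: runs_mono)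
qed

definition adj_nbhd :: "nat list list \<Rightarrow> nat \<Rightarrow> nat set" where
  "adj_nbhd A v = insert v (set (A ! v))"

text \<open>Without repetitions and loops, \<open>v\<close> followed by its list meets each member
  of the closed neighbourhood exactly once, so nothing is summed or charged twice.\<close>

definition adj_lists :: "nat list list \<Rightarrow> bool" where
  "adj_lists A \<longleftrightarrow> (\<forall>v<length A. distinct (A ! v) \<and> v \<notin> set (A ! v))"

lemma set_take_Suc: "j < length xs \<Longrightarrow> set (take (Suc j) xs) = insert (xs ! j) (set (take j xs))"
  by (simp add: take_Suc_conv_app_nth)

lemma nth_notin_set_take:
  assumes "distinct xs" "j < length xs"
  shows "xs ! j \<notin> set (take j xs)"
  using assms by (auto simp: in_set_conv_nth nth_eq_iff_index_eq)

lemma for_adj_min: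
  assumes "v < length A" "graph_input A U xs s" "s ''v'' 0 = v" "s ''m'' 0 = min (U v) (s ''k'' v)"
  shows "runs (for_adj min_com) s (\<lambda>t s'. t \<le> length (A ! v) * 35 + 15 \<and>
    s' ''m'' 0 = room (adj_nbhd A) U (s ''k'') v \<and> (\<forall>x. x \<notin> {''m'', ''p''} \<longrightarrow> s' x = s x))"
proof -
  define M where "M j = Min (insert (U v) (s ''k'' ` insert v (set (take j (A ! v)))))" for j
  have M_Suc: "M (Suc j) = min (s ''k'' (A ! v ! j)) (M j)" if "j < length (A ! v)" for j
  proof -
    let ?S = "insert (U v) (s ''k'' ` insert v (set (take j (A ! v))))"
    have "M (Suc j) = Min (insert (s ''k'' (A ! v ! j)) ?S)"
      unfolding M_def using that by (intro arg_cong[of _ _ Min]) (auto simp: set_take_Suc)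
    also have "\<dots> = min (s ''k'' (A ! v ! j)) (Min ?S)"
      by (rule Min_insert) auto
    finally show ?thesis by (simp add: M_def)
  qed
  define J where "J j s' \<longleftrightarrow> s' ''m'' 0 = M j \<and> (\<forall>x. x \<notin> {''m'', ''p''} \<longrightarrow> s' x = s x)" for j s'
  have "runs (for_adj min_com) s (\<lambda>t s'. t \<le> length (A ! v) * (20 + 15) + 15 \<and> J (length (A ! v)) s')"
  proof (rule for_adj_runs)
    fix j s' assume j: "j < length (A ! v)" and J: "J j s'" and adj: "s' ''adj'' (s' ''p'' 0) = A ! v ! j"
    have "s' ''k'' = s ''k''" using J by (auto simp: J_def)
    then show "runs min_com s' (\<lambda>t s''. t \<le> 20 \<and> J (Suc j) s'' \<and> s'' ''p'' = s' ''p'')"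
      using J adj M_Suc[OF j] by (simp add: runs_simps J_def min_com_def)
  qed (use assms in \<open>auto simp: J_def M_def graph_input_def\<close>)
  then show ?thesis
    by (rule runs_mono) (auto simp: J_def M_def room_def adj_nbhd_def)
qed

text \<open>\<open>K\<close> holds the capacities before the whole step; the row of \<open>v\<close>
  has already been charged when the scan starts.\<close>

lemma for_adj_consume:
  assumes "v < length A" "graph_input A U xs s" "s ''v'' 0 = v" "adj_lists A"
    and "s ''k'' = K(v := K v - s ''m'' 0)"
  shows "runs (for_adj consume_com) s (\<lambda>t s'. t \<le> length (A ! v) * 35 + 15 \<and>
    s' ''k'' = consume (adj_nbhd A) K v (s ''m'' 0) \<and> (\<forall>x. x \<notin> {''k'', ''p''} \<longrightarrow> s' x = s x))"
proof -
  define C where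
    "C j w = (if w \<in> insert v (set (take j (A ! v))) then K w - s ''m'' 0 else K w)" for j w
  have C_Suc: "C (Suc j) = (C j)(A ! v ! j := C j (A ! v ! j) - s ''m'' 0)"
    if j: "j < length (A ! v)" for j
  proof -
    \<comment> \<open>The next row is still uncharged, so the program subtracts from its original
      capacity.\<close>
    have "A ! v ! j \<notin> insert v (set (take j (A ! v)))"
      using assms(1,4) j nth_notin_set_take[of "A ! v" j] nth_mem[OF j]
      by (auto simp: adj_lists_def simp del: nth_mem)
    then show ?thesis
      by (auto simp: C_def set_take_Suc[OF j] fun_eq_iff)
  qed
  define J where "J j s' \<longleftrightarrow> s' ''k'' = C j \<and> (\<forall>x. x \<notin> {''k'', ''p''} \<longrightarrow> s' x = s x)" for j s'
  have "runs (for_adj consume_com) s (\<lambda>t s'. t \<le> length (A ! v) * (20 + 15) + 15 \<and> J (length (A ! v)) s')"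
  proof (rule for_adj_runs)
    fix j s' assume j: "j < length (A ! v)" and J: "J j s'" and adj: "s' ''adj'' (s' ''p'' 0) = A ! v ! j"
    have "s' ''m'' = s ''m''" using J by (auto simp: J_def)
    then show "runs consume_com s' (\<lambda>t s''. t \<le> 20 \<and> J (Suc j) s'' \<and> s'' ''p'' = s' ''p'')"
      using J adj C_Suc[OF j] by (simp add: runs_simps J_def consume_com_def)
  qed (use assms in \<open>auto simp: J_def C_def fun_eq_iff graph_input_def\<close>)
  then show ?thesis
    by (rule runs_mono) (auto simp: J_def C_def consume_def adj_nbhd_def fun_eq_iff)
qed

lemma for_adj_sum:
  assumes "v < length A" "graph_input A U xs s" "s ''v'' 0 = v" "adj_lists A" "s ''m'' 0 = U v"
  shows "runs (for_adj sum_com) s (\<lambda>t s'. t \<le> length (A ! v) * 35 + 15 \<and>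
    s' ''m'' 0 = sum U (adj_nbhd A v) \<and> (\<forall>x. x \<notin> {''m'', ''p''} \<longrightarrow> s' x = s x))"
proof -
  define J where "J j s' \<longleftrightarrow>
    s' ''m'' 0 = sum U (insert v (set (take j (A ! v)))) \<and>
    (\<forall>x. x \<notin> {''m'', ''p''} \<longrightarrow> s' x = s x)" for j s'
  have "runs (for_adj sum_com) s (\<lambda>t s'. t \<le> length (A ! v) * (20 + 15) + 15 \<and> J (length (A ! v)) s')"
  proof (rule for_adj_runs)
    fix j s' assume j: "j < length (A ! v)" and J: "J j s'" and adj: "s' ''adj'' (s' ''p'' 0) = A ! v ! j"
    let ?S = "insert v (set (take j (A ! v)))"
    have "A ! v ! j \<notin> ?S"
      using assms(1,4) j nth_notin_set_take[of "A ! v" j] nth_mem[OF j]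
      by (auto simp: adj_lists_def simp del: nth_mem)
    then have "sum U (insert (A ! v ! j) ?S) = U (A ! v ! j) + sum U ?S"
      by (intro sum.insert) auto
    then have "sum U (insert v (set (take (Suc j) (A ! v)))) = s' ''m'' 0 + U (A ! v ! j)"
      using J by (simp add: J_def set_take_Suc[OF j] insert_commute)
    moreover have "s' ''u'' = U" using J assms(2) by (auto simp: J_def graph_input_def)
    moreover have "s' ''adj'' = s ''adj''" using J by (auto simp: J_def)
    ultimately show "runs sum_com s' (\<lambda>t s''. t \<le> 20 \<and> J (Suc j) s'' \<and> s'' ''p'' = s' ''p'')"
      using J adj unfolding J_def sum_com_def by (auto simp: runs_simps)
  qed (use assms in \<open>auto simp: J_def graph_input_def\<close>)
  then show ?thesis
    by (rule runs_mono) (auto simp: J_def adj_nbhd_def)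
qed

section \<open>The main loops and their running times\<close>

lemma greedy_step_runs:
  assumes A: "adj_lists A" and input: "graph_input A U xs s"
    and i: "s ''i'' 0 = i" "i < length xs" and v: "v = xs ! i" "v < length A"
  shows "runs greedy_step s (\<lambda>t s'. t \<le> 100 + 70 * length (A ! v) \<and> graph_input A U xs s' \<and>
    s' ''i'' 0 = Suc i \<and> s' ''opt'' 0 = s ''opt'' 0 + room (adj_nbhd A) U (s ''k'') v \<and>
    s' ''k'' = consume (adj_nbhd A) (s ''k'') v (room (adj_nbhd A) U (s ''k'') v) \<and>
    s' ''tot'' = s ''tot'' \<and> s' ''feasible'' = s ''feasible'')"
    (is "runs _ _ (\<lambda>t s'. t \<le> _ \<and> ?P s')")
proof -
  let ?d = "length (A ! v)" and ?m = "room (adj_nbhd A) U (s ''k'') v"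
  define I where "I s' \<longleftrightarrow> graph_input A U xs s' \<and> s' ''i'' 0 = i \<and> s' ''v'' 0 = v \<and>
    s' ''tot'' = s ''tot'' \<and> s' ''feasible'' = s ''feasible''" for s'
  \<comment> \<open>\<open>c1\<close> and \<open>c2\<close> are the tails of the step that begin
    with its two scans. They are treated from the end backwards, with plain symbolic execution in
    between.\<close>
  define c1 where "c1 = Seq (for_adj consume_com) (set_var ''i'' (Add (var ''i'') (Const 1)))"
  define c2 where "c2 = Seq (for_adj min_com)
    (Seq (set_var ''opt'' (Add (var ''opt'') (var ''m'')))
    (Seq (Store ''k'' (var ''v'') (Sub (Load ''k'' (var ''v'')) (var ''m''))) c1))"
  have c1: "runs c1 s1 (\<lambda>t s'. t \<le> 25 + 35 * ?d \<and> ?P s')"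
    if "I s1" "s1 ''m'' 0 = ?m" "s1 ''opt'' 0 = s ''opt'' 0 + ?m"
      "s1 ''k'' = (s ''k'')(v := s ''k'' v - ?m)" for s1
  proof -
    have "runs (for_adj consume_com) s1 (\<lambda>t s'. t \<le> ?d * 35 + 15 \<and>
        s' ''k'' = consume (adj_nbhd A) (s ''k'') v (s1 ''m'' 0) \<and>
        (\<forall>x. x \<notin> {''k'', ''p''} \<longrightarrow> s' x = s1 x))"
      using that A v by (intro for_adj_consume) (auto simp: I_def)
    then show ?thesis
      unfolding c1_def runs_Seq
      by (rule runs_mono) (use that in \<open>auto simp: runs_Store I_def graph_input_def\<close>)
  qed
  have c2: "runs c2 s1 (\<lambda>t s'. t \<le> 60 + 70 * ?d \<and> ?P s')"
    if "I s1" "s1 ''m'' 0 = min (U v) (s ''k'' v)" "s1 ''opt'' 0 = s ''opt'' 0"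
      "s1 ''k'' = s ''k''" for s1
  proof -
    have "runs (for_adj min_com) s1 (\<lambda>t s'. t \<le> ?d * 35 + 15 \<and>
        s' ''m'' 0 = room (adj_nbhd A) U (s1 ''k'') v \<and>
        (\<forall>x. x \<notin> {''m'', ''p''} \<longrightarrow> s' x = s1 x))"
      using that v by (intro for_adj_min) (auto simp: I_def)
    then show ?thesis
      unfolding c2_def runs_Seq[of "for_adj min_com"]
    proof (rule runs_mono)
      fix t s'
      assume *: "t \<le> ?d * 35 + 15 \<and> s' ''m'' 0 = room (adj_nbhd A) U (s1 ''k'') v \<and>
        (\<forall>x. x \<notin> {''m'', ''p''} \<longrightarrow> s' x = s1 x)"
      let ?s1 = "s'(''opt'' := (s' ''opt'')(0 := s' ''opt'' 0 + ?m))"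
      let ?s2 = "?s1(''k'' := (s' ''k'')(v := s' ''k'' v - ?m))"
      have "runs c1 ?s2 (\<lambda>t s'. t \<le> 25 + 35 * ?d \<and> ?P s')"
        using * that by (intro c1) (auto simp: I_def graph_input_def)
      \<comment> \<open>The two assignments before \<open>c1\<close> cost 7 and 9 steps; the 20
        allowed here exhaust the bound, as 15 + 25 + 20 = 60.\<close>
      then have "runs c1 ?s2 (\<lambda>t' s'. t + (5 + (7 + t')) + 8 \<le> 60 + 70 * ?d \<and> ?P s')"
        by (rule runs_mono) (use * in auto)
      moreover have "s' ''v'' 0 = v" "s' ''m'' 0 = ?m"
        using * that by (auto simp: I_def)
      ultimately show "runs (Seq (set_var ''opt'' (Add (var ''opt'') (var ''m'')))
          (Seq (Store ''k'' (var ''v'') (Sub (Load ''k'' (var ''v'')) (var ''m''))) c1)) s'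
          (\<lambda>t' s'. t + t' \<le> 60 + 70 * ?d \<and> ?P s')"
        by (simp add: runs_Seq runs_Store add.commute add.left_commute) (erule runs_mono, auto)
    qed
  qed
  have [simp]: "s ''ord'' i = v" "s ''u'' = U"
    using input i v by (auto simp: graph_input_def array_def)
  \<comment> \<open>\<open>s1\<close> and \<open>s2\<close> are the memories after the two outcomes
    of the initial comparison; in either one \<open>m\<close> is the minimum of \<open>U v\<close>
    and the capacity of \<open>v\<close>.\<close>
  define s1 where "s1 = s(''v'' := (s ''v'')(0 := v), ''m'' := (s ''m'')(0 := U v))"
  define s2 where "s2 = s1(''m'' := (s1 ''m'')(0 := s ''k'' v))"
  have "runs c2 s1 (\<lambda>t s'. t \<le> 60 + 70 * ?d \<and> ?P s')" if "\<not> s ''k'' v < U v"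
    using that input i by (intro c2) (auto simp: I_def s1_def graph_input_upd)
  moreover have "runs c2 s2 (\<lambda>t s'. t \<le> 60 + 70 * ?d \<and> ?P s')" if "s ''k'' v < U v"
    using that input i by (intro c2) (auto simp: I_def s1_def s2_def graph_input_upd)
  ultimately show ?thesis
    unfolding greedy_step_def c1_def[symmetric] c2_def[symmetric]
    by (auto simp: runs_simps i s1_def s2_def elim!: runs_mono)
qed

lemma sum_list_nth: "(\<Sum>j<length xs. f (xs ! j)) = (\<Sum>x\<leftarrow>xs. f x)" for f :: "'a \<Rightarrow> nat"
  by (simp add: sum_list_sum_nth atLeast0LessThan)

text \<open>The invariant is conservation: the value collected in \<open>opt\<close> plus the greedy
  value of the unprocessed suffix, under the current capacities, stays constant.\<close>

lemma gpf_com_runs: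
  assumes A: "adj_lists A" and input: "graph_input A U xs s"
    and xs: "distinct xs" "set xs = {..<length A}" and init: "s ''i'' 0 = 0" "s ''opt'' 0 = 0"
  shows "runs gpf_com s (\<lambda>t s'. t \<le> 110 * length A + 70 * length (concat A) + 10 \<and>
    s' ''opt'' 0 = greedy (adj_nbhd A) U xs (s ''k'') \<and>
    s' ''tot'' = s ''tot'' \<and> s' ''feasible'' = s ''feasible'')"
proof -
  let ?g = "\<lambda>j. greedy (adj_nbhd A) U (drop j xs)"
  define I where "I j s' \<longleftrightarrow> graph_input A U xs s' \<and> s' ''i'' 0 = j \<and>
    s' ''opt'' 0 + ?g j (s' ''k'') = greedy (adj_nbhd A) U xs (s ''k'') \<and>
    s' ''tot'' = s ''tot'' \<and> s' ''feasible'' = s ''feasible''" for j s'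
  let ?B = "\<lambda>j. 100 + 70 * length (A ! (xs ! j))"
  let ?b = "Less (var ''i'') (var ''n'')"
  have len: "length xs = length A"
    using distinct_card[OF xs(1)] xs(2) by simp
  have "runs gpf_com s (\<lambda>t s'. t \<le> (\<Sum>j<length xs. ?B j) + Suc (length xs) * (1 + bcost ?b) \<and>
      I (length xs) s')"
    unfolding gpf_com_def
  proof (rule runs_While)
    show "I 0 s" using input init by (simp add: I_def)
  next
    fix j s' assume j: "j < length xs" and I: "I j s'"
    have "xs ! j < length A"
      using xs(2) nth_mem[OF j] by blast
    then have "runs greedy_step s' (\<lambda>t s''. t \<le> ?B j \<and> graph_input A U xs s'' \<and>
        s'' ''i'' 0 = Suc j \<and> s'' ''opt'' 0 = s' ''opt'' 0 + room (adj_nbhd A) U (s' ''k'') (xs ! j) \<and>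
        s'' ''k'' = consume (adj_nbhd A) (s' ''k'') (xs ! j) (room (adj_nbhd A) U (s' ''k'') (xs ! j)) \<and>
        s'' ''tot'' = s' ''tot'' \<and> s'' ''feasible'' = s' ''feasible'')"
      using I j A by (intro greedy_step_runs) (auto simp: I_def)
    then have "runs greedy_step s' (\<lambda>t s''. t \<le> ?B j \<and> I (Suc j) s'')"
      by (rule runs_mono) (use I j in \<open>auto simp: I_def Cons_nth_drop_Suc[symmetric]\<close>)
    then show "bval ?b s' \<and> runs greedy_step s' (\<lambda>t s''. t \<le> ?B j \<and> I (Suc j) s'')"
      using I j len by (simp add: I_def graph_input_def)
  next
    fix s' assume "I (length xs) s'"
    then show "\<not> bval ?b s'" using len by (simp add: I_def graph_input_def)
  qed
  \<comment> \<open>Since \<open>xs\<close> permutes the vertex numbers, the budgets of the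
    iterations add up to the total length of all adjacency lists.\<close>
  moreover have "(\<Sum>j<length xs. length (A ! (xs ! j))) = length (concat A)"
  proof -
    have "(\<Sum>j<length xs. length (A ! (xs ! j))) = (\<Sum>v<length A. length (A ! v))"
      using sum_list_nth[of "\<lambda>v. length (A ! v)" xs] xs by (simp add: sum_list_distinct_conv_sum_set)
    then show ?thesis
      using sum_list_nth[of length A] by (simp add: length_concat)
  qed
  then have "(\<Sum>j<length xs. ?B j) = 100 * length A + 70 * length (concat A)"
    using len by (simp add: sum.distrib flip: sum_distrib_left)
  ultimately show ?thesis
    by (elim runs_mono) (auto simp: I_def len)
qed

lemma complement_step_runs:
  assumes A: "adj_lists A" and input: "graph_input A U xs s" and v: "s ''v'' 0 = v" "v < length A"
  shows "runs complement_step s (\<lambda>t s'. t \<le> 100 + 35 * length (A ! v) \<and> graph_input A U xs s' \<and>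
    s' ''v'' 0 = Suc v \<and> s' ''tot'' 0 = s ''tot'' 0 + U v \<and>
    s' ''feasible'' 0 = (if sum U (adj_nbhd A v) < s ''k'' v then 0 else s ''feasible'' 0) \<and>
    s' ''k'' = (s ''k'')(v := sum U (adj_nbhd A v) - s ''k'' v) \<and>
    s' ''i'' = s ''i'' \<and> s' ''opt'' = s ''opt'')"
    (is "runs _ _ (\<lambda>t s'. t \<le> _ \<and> ?P s')")
proof -
  let ?d = "length (A ! v)"
  define s1 where "s1 = s(''m'' := (s ''m'')(0 := U v), ''tot'' := (s ''tot'')(0 := s ''tot'' 0 + U v))"
  define c1 where "c1 =
     Seq (Cond (Less (var ''m'') (Load ''k'' (var ''v''))) (set_var ''feasible'' (Const 0)) Skip)
    (Seq (Store ''k'' (var ''v'') (Sub (var ''m'') (Load ''k'' (var ''v''))))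
         (set_var ''v'' (Add (var ''v'') (Const 1))))"
  have "runs (for_adj sum_com) s1 (\<lambda>t s'. t \<le> ?d * 35 + 15 \<and> s' ''m'' 0 = sum U (adj_nbhd A v) \<and>
      (\<forall>x. x \<notin> {''m'', ''p''} \<longrightarrow> s' x = s1 x))"
    using assms by (intro for_adj_sum) (auto simp: s1_def graph_input_upd)
  then have "runs (Seq (for_adj sum_com) c1) s1 (\<lambda>t s'. t \<le> 70 + 35 * ?d \<and> ?P s')"
    unfolding runs_Seq[of "for_adj sum_com"]
  proof (rule runs_mono)
    fix t s'
    assume *: "t \<le> ?d * 35 + 15 \<and> s' ''m'' 0 = sum U (adj_nbhd A v) \<and>
      (\<forall>x. x \<notin> {''m'', ''p''} \<longrightarrow> s' x = s1 x)"
    then have "graph_input A U xs s'"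
      using input by (simp add: s1_def graph_input_def)
    moreover have "s' ''v'' 0 = v" "s' ''tot'' 0 = s ''tot'' 0 + U v" "s' ''feasible'' = s ''feasible''"
      "s' ''k'' = s ''k''" "s' ''i'' = s ''i''" "s' ''opt'' = s ''opt''"
      using * v by (simp_all add: s1_def)
    ultimately show "runs c1 s' (\<lambda>t' s'. t + t' \<le> 70 + 35 * ?d \<and> ?P s')"
      using * by (simp add: c1_def runs_simps graph_input_upd)
  qed
  moreover have "s ''u'' = U"
    using input by (simp add: graph_input_def)
  ultimately show ?thesis
    unfolding complement_step_def c1_def[symmetric] runs_Seq[of "set_var _ _"]
    by (auto simp: runs_Store v s1_def elim!: runs_mono)
qed

lemma gdf_com_runs:
  assumes A: "adj_lists A" and input: "graph_input A U xs s"
    and xs: "distinct xs" "set xs = {..<length A}"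
    and init: "s ''i'' 0 = 0" "s ''opt'' 0 = 0" "s ''v'' 0 = 0" "s ''tot'' 0 = 0"
    and K: "\<forall>v\<ge>length A. s ''k'' v = 0"
  shows "runs gdf_com s (\<lambda>t s'. t \<le> 220 * length A + 105 * length (concat A) + 40 \<and>
    s' ''feasible'' 0 = (if \<forall>v<length A. s ''k'' v \<le> sum U (adj_nbhd A v) then 1 else 0) \<and>
    s' ''opt'' 0 = sum U {..<length A} - greedy (adj_nbhd A) U xs
      (\<lambda>v. if v < length A then sum U (adj_nbhd A v) - s ''k'' v else 0))"
proof -
  \<comment> \<open>The half-converted array: packing capacities below \<open>j\<close>, original
    demands from \<open>j\<close> on.\<close>
  define C where "C j v = (if v < j then sum U (adj_nbhd A v) - s ''k'' v else s ''k'' v)" for j v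
  define F where "F j = (if \<forall>v<j. s ''k'' v \<le> sum U (adj_nbhd A v) then 1 else 0 :: nat)" for j
  define I where "I j s' \<longleftrightarrow> graph_input A U xs s' \<and> s' ''v'' 0 = j \<and>
    s' ''tot'' 0 = sum U {..<j} \<and> s' ''k'' = C j \<and> s' ''feasible'' 0 = F j \<and>
    s' ''i'' 0 = 0 \<and> s' ''opt'' 0 = 0" for j s'
  let ?n = "length A" and ?B = "\<lambda>j. 100 + 35 * length (A ! j)" and ?b = "Less (var ''v'') (var ''n'')"
  let ?g = "greedy (adj_nbhd A) U xs (C ?n)"
  define s1 where "s1 = s(''feasible'' := (s ''feasible'')(0 := 1))"
  have C_Suc: "C (Suc j) = (C j)(j := sum U (adj_nbhd A j) - C j j)" for j
    by (auto simp: C_def fun_eq_iff less_Suc_eq)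
  have F_Suc: "F (Suc j) = (if sum U (adj_nbhd A j) < C j j then 0 else F j)" for j
    by (auto simp: F_def C_def less_Suc_eq)
  have "runs (While ?b complement_step) s1
      (\<lambda>t s'. t \<le> (\<Sum>j<?n. ?B j) + Suc ?n * (1 + bcost ?b) \<and> I ?n s')"
  proof (rule runs_While)
    show "I 0 s1" using input init by (auto simp: I_def s1_def C_def F_def graph_input_upd)
  next
    fix j s' assume j: "j < ?n" and I: "I j s'"
    have "runs complement_step s' (\<lambda>t s''. t \<le> ?B j \<and> graph_input A U xs s'' \<and>
      s'' ''v'' 0 = Suc j \<and> s'' ''tot'' 0 = s' ''tot'' 0 + U j \<and>
      s'' ''feasible'' 0 = (if sum U (adj_nbhd A j) < s' ''k'' j then 0 else s' ''feasible'' 0) \<and>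
      s'' ''k'' = (s' ''k'')(j := sum U (adj_nbhd A j) - s' ''k'' j) \<and>
      s'' ''i'' = s' ''i'' \<and> s'' ''opt'' = s' ''opt'')"
      using I j A by (intro complement_step_runs) (auto simp: I_def)
    then have "runs complement_step s' (\<lambda>t s''. t \<le> ?B j \<and> I (Suc j) s'')"
      by (rule runs_mono) (use I in \<open>simp add: I_def C_Suc F_Suc\<close>)
    then show "bval ?b s' \<and> runs complement_step s' (\<lambda>t s''. t \<le> ?B j \<and> I (Suc j) s'')"
      using I j by (simp add: I_def graph_input_def)
  next
    fix s' assume "I ?n s'"
    then show "\<not> bval ?b s'" by (simp add: I_def graph_input_def)
  qed
  moreover have "(\<Sum>j<?n. ?B j) = 100 * ?n + 35 * length (concat A)"
    using sum_list_nth[of length A] by (simp add: sum.distrib length_concat flip: sum_distrib_left)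
  ultimately have "runs (While ?b complement_step) s1
      (\<lambda>t s'. t \<le> 110 * ?n + 35 * length (concat A) + 10 \<and> I ?n s')"
    by (elim runs_mono) auto
  then have "runs (Seq (While ?b complement_step)
      (Seq gpf_com (set_var ''opt'' (Sub (var ''tot'') (var ''opt''))))) s1
      (\<lambda>t s'. t \<le> 220 * ?n + 105 * length (concat A) + 30 \<and> s' ''feasible'' 0 = F ?n \<and>
        s' ''opt'' 0 = sum U {..<?n} - ?g)"
    unfolding runs_Seq[of "While _ _"]
  proof (rule runs_mono)
    fix t s'
    assume *: "t \<le> 110 * ?n + 35 * length (concat A) + 10 \<and> I ?n s'"
    have "runs gpf_com s' (\<lambda>t s''. t \<le> 110 * ?n + 70 * length (concat A) + 10 \<and>
        s'' ''opt'' 0 = greedy (adj_nbhd A) U xs (s' ''k'') \<and>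
        s'' ''tot'' = s' ''tot'' \<and> s'' ''feasible'' = s' ''feasible'')"
      using * A xs by (intro gpf_com_runs) (auto simp: I_def)
    then show "runs (Seq gpf_com (set_var ''opt'' (Sub (var ''tot'') (var ''opt'')))) s'
        (\<lambda>t' s''. t + t' \<le> 220 * ?n + 105 * length (concat A) + 30 \<and> s'' ''feasible'' 0 = F ?n \<and>
          s'' ''opt'' 0 = sum U {..<?n} - ?g)"
      unfolding runs_Seq
      by (rule runs_mono) (use * in \<open>auto simp: runs_Store I_def\<close>)
  qed
  \<comment> \<open>Beyond the vertex numbers the array is unchanged, and \<open>K\<close> says that
    it is zero there.\<close>
  moreover have "C ?n = (\<lambda>v. if v < ?n then sum U (adj_nbhd A v) - s ''k'' v else 0)"
    using K by (auto simp: C_def)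
  ultimately show ?thesis
    unfolding gdf_com_def runs_Seq[of "set_var _ _"] runs_Store
    by (auto simp: s1_def F_def elim!: runs_mono)
qed

section \<open>Encoded instances\<close>

text \<open>Each list entry is an ordered adjacent pair, determined by its edge and by whether its
  first number is the smaller one. This gives an injection into edges times booleans.\<close>

lemma sum_degrees_le:
  assumes "finite V" "\<forall>e\<in>E. e \<subseteq> V \<and> card e = 2" "distinct ns" "length A = length ns"
    and A: "\<forall>i<length ns. distinct (A ! i) \<and>
      set (A ! i) = {j. j < length ns \<and> {ns ! i, ns ! j} \<in> E}"
  shows "length (concat A) \<le> 2 * card E"
proof -
  let ?S = "Sigma {..<length ns} (\<lambda>i. set (A ! i))"
  let ?h = "\<lambda>(i, j). ({ns ! i, ns ! j}, i < j)"
  have "finite E"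
    using assms(1,2) by (meson PowI finite_Pow_iff finite_subset subsetI)
  have "length (concat A) = (\<Sum>i<length ns. card (set (A ! i)))"
    unfolding length_concat sum_list_nth[of length A, symmetric] assms(4)
    by (rule sum.cong) (use A distinct_card in \<open>force+\<close>)
  also have "\<dots> = card ?S" by simp
  also have "\<dots> \<le> card (E \<times> (UNIV :: bool set))"
  proof (rule card_inj_on_le)
    show "?h ` ?S \<subseteq> E \<times> UNIV" using A by auto
    show "finite (E \<times> (UNIV :: bool set))" using \<open>finite E\<close> by simp
    show "inj_on ?h ?S"
    proof (rule inj_onI, clarify)
      fix i j i' j'
      assume *: "i < length ns" "i' < length ns" "j \<in> set (A ! i)" "j' \<in> set (A ! i')"
        "{ns ! i, ns ! j} = {ns ! i', ns ! j'}" "(i < j) = (i' < j')"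
      then have "j < length ns" "j' < length ns" using A by auto
      with * have "i = i' \<and> j = j' \<or> i = j' \<and> j = i'"
        using \<open>distinct ns\<close> by (auto simp: doubleton_eq_iff nth_eq_iff_index_eq)
      \<comment> \<open>Swapped pairs would satisfy \<open>(i < j) = (j < i)\<close>, which forces
        \<open>i = j\<close>, and then they coincide.\<close>
      with *(6) show "i = i' \<and> j = j'" by auto
    qed
  qed
  also have "\<dots> = 2 * card E" by (simp add: card_cartesian_product)
  finally show ?thesis .
qed

lemma encoded_instance:
  assumes graph: "simple_graph V E" and seo: "strong_elimination_ordering V E vs"
    and enc: "encodes_instance s V E vs k u"
  obtains ns A xs where "bij_betw (nth ns) {..<length A} V" "adj_lists A"
    "graph_input A (array (map u ns)) xs s" "s ''k'' = array (map k ns)"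
    "distinct xs" "set xs = {..<length A}" "map (nth ns) xs = vs" "length ns = length A"
    "\<And>i. i < length A \<Longrightarrow> adj_nbhd A i \<subseteq> {..<length A}"
    "\<And>i. i < length A \<Longrightarrow> closed_nbhd V E (ns ! i) = nth ns ` adj_nbhd A i"
    "length A = card V" "length (concat A) \<le> 2 * card E"
    "s ''i'' 0 = 0" "s ''opt'' 0 = 0" "s ''v'' 0 = 0" "s ''tot'' 0 = 0"
proof -
  obtain ns A xs where ns: "distinct ns" "set ns = V" and lenA: "length A = length ns"
    and A: "\<forall>i<length ns. distinct (A ! i) \<and>
      set (A ! i) = {j. j < length ns \<and> {ns ! i, ns ! j} \<in> E}"
    and xs: "\<forall>i\<in>set xs. i < length ns" "map (\<lambda>i. ns ! i) xs = vs"
    and s: "s = (\<lambda>_ _. 0)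
          (''n'' := array [length ns],
           ''off'' := array (map (\<lambda>i. length (concat (take i A))) [0..<length ns + 1]),
           ''adj'' := array (concat A),
           ''ord'' := array xs,
           ''k'' := array (map k ns),
           ''u'' := array (map u ns))"
    using enc unfolding encodes_instance_def by blast
  have bij: "bij_betw (nth ns) {..<length A} V"
    using ns lenA by (auto intro: bij_betw_nth)
  have E: "\<forall>e\<in>E. e \<subseteq> V \<and> card e = 2" "finite V"
    using graph by (auto simp: simple_graph_def)
  have vs: "distinct vs" "set vs = V"
    using seo by (auto simp: strong_elimination_ordering_def)
  \<comment> \<open>A vertex in its own adjacency list would yield the edge \<open>{x}\<close>,
    which has cardinality 1.\<close>
  have "{x} \<notin> E" for x using E(1) by force
  then have adj: "adj_lists A"
    using A lenA by (auto simp: adj_lists_def)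
  have input: "graph_input A (array (map u ns)) xs s"
    unfolding s graph_input_def by (auto simp: array_def lenA nth_append simp del: upt_Suc)
  have dxs: "distinct xs"
    using xs(2) vs(1) by (auto simp: distinct_map)
  have sxs: "set xs = {..<length A}"
  proof (rule card_subset_eq)
    show "set xs \<subseteq> {..<length A}" using xs(1) lenA by auto
    show "card (set xs) = card {..<length A}"
      using distinct_card[OF dxs] distinct_card[OF vs(1)] distinct_card[OF ns(1)] xs(2) vs(2) ns(2) lenA
      by auto
  qed simp
  have nb: "adj_nbhd A i \<subseteq> {..<length A}"
    "closed_nbhd V E (ns ! i) = nth ns ` adj_nbhd A i" if "i < length A" for i
  proof -
    show "adj_nbhd A i \<subseteq> {..<length A}"
      using A that lenA by (auto simp: adj_nbhd_def)
    show "closed_nbhd V E (ns ! i) = nth ns ` adj_nbhd A i"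
      using A that lenA ns(2) by (auto simp: adj_nbhd_def closed_nbhd_def in_set_conv_nth)
  qed
  have "length A = card V" using ns lenA distinct_card by metis
  moreover have "length (concat A) \<le> 2 * card E"
    using sum_degrees_le[OF E(2,1) ns(1) lenA A] .
  moreover have "s ''k'' = array (map k ns)"
    "s ''i'' 0 = 0" "s ''opt'' 0 = 0" "s ''v'' 0 = 0" "s ''tot'' 0 = 0"
    unfolding s by simp_all
  ultimately show ?thesis
    using that bij adj input dxs sxs xs(2) lenA nb by metis
qed

section \<open>Correctness of both programs with a linear time bound\<close>

lemma linear_bigo: "(\<lambda>N. real (a * N + b)) \<in> O(\<lambda>N. real N)"
proof (rule bigoI)
  show "\<forall>\<^sub>F N in sequentially. norm (real (a * N + b)) \<le> real (a + b) * norm (real N)"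
    using eventually_ge_at_top[of 1]
  proof eventually_elim
    case (elim N)
    then have "b * 1 \<le> b * N" by (intro mult_le_mono) auto
    then have "a * N + b \<le> (a + b) * N" by (simp add: algebra_simps)
    then show ?case by (metis norm_of_nat of_nat_le_iff of_nat_mult)
  qed
qed

text \<open>At most two list entries per edge turn the step count into at most 110 per vertex, 140
  per edge and 10 more. The constants 400 and 100 are a generous bound that also covers the
  domination program.\<close>

lemma gpf_com_correct:
  assumes graph: "simple_graph V E" and seo: "strong_elimination_ordering V E vs"
    and enc: "encodes_instance s V E vs k u"
  shows "halts_within gpf_com s (400 * (card V + card E) + 100) (gpf_output V E k u)"
proof -
  from encoded_instance[OF assms] obtain ns A xs where
    bij: "bij_betw (nth ns) {..<length A} V" and input: "adj_lists A"
    "graph_input A (array (map u ns)) xs s" and k: "s ''k'' = array (map k ns)"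
    and xs: "distinct xs" "set xs = {..<length A}" and vs: "map (nth ns) xs = vs"
    and len: "length ns = length A"
    and nb: "\<And>i. i < length A \<Longrightarrow> adj_nbhd A i \<subseteq> {..<length A}"
    "\<And>i. i < length A \<Longrightarrow> closed_nbhd V E (ns ! i) = nth ns ` adj_nbhd A i"
    and cards: "length A = card V" "length (concat A) \<le> 2 * card E"
    and init: "s ''i'' 0 = 0" "s ''opt'' 0 = 0"
    by metis
  have "greedy (adj_nbhd A) (array (map u ns)) xs (s ''k'') =
      greedy (closed_nbhd V E) u (map (nth ns) xs) k"
    by (rule greedy_map[where I = "{..<length A}"])
      (use nb xs k len bij in \<open>auto simp: array_def bij_betw_def\<close>)
  then have "gpf_output V E k u s'"
    if "s' ''opt'' 0 = greedy (adj_nbhd A) (array (map u ns)) xs (s ''k'')" for s'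
    using that greedy_gpf_maximum[OF graph seo] vs by (simp add: gpf_output_def)
  with gpf_com_runs[OF input xs init] cards show ?thesis
    unfolding halts_within_runs by (elim runs_mono) auto
qed

lemma gdf_com_correct:
  assumes graph: "simple_graph V E" and seo: "strong_elimination_ordering V E vs"
    and enc: "encodes_instance s V E vs k u"
  shows "halts_within gdf_com s (400 * (card V + card E) + 100) (gdf_output V E k u)"
proof -
  from encoded_instance[OF assms] obtain ns A xs where
    bij: "bij_betw (nth ns) {..<length A} V" and input: "adj_lists A"
    "graph_input A (array (map u ns)) xs s" and k: "s ''k'' = array (map k ns)"
    and xs: "distinct xs" "set xs = {..<length A}" and vs: "map (nth ns) xs = vs"
    and len: "length ns = length A"
    and nb: "\<And>i. i < length A \<Longrightarrow> adj_nbhd A i \<subseteq> {..<length A}"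
    "\<And>i. i < length A \<Longrightarrow> closed_nbhd V E (ns ! i) = nth ns ` adj_nbhd A i"
    and cards: "length A = card V" "length (concat A) \<le> 2 * card E"
    and init: "s ''i'' 0 = 0" "s ''opt'' 0 = 0" "s ''v'' 0 = 0" "s ''tot'' 0 = 0"
    by metis
  let ?U = "array (map u ns)" and ?N = "closed_nbhd V E"
  let ?k = "\<lambda>v. sum u (?N v) - k v"
  let ?K = "\<lambda>v. if v < length A then sum ?U (adj_nbhd A v) - s ''k'' v else 0"
  have inj: "inj_on (nth ns) {..<length A}" and V: "V = nth ns ` {..<length A}"
    using bij by (auto simp: bij_betw_def)
  have U: "?U i = u (ns ! i)" and K: "s ''k'' i = k (ns ! i)" if "i < length A" for i
    using that len k by (auto simp: array_def)
  have sum_U: "sum ?U X = sum u (nth ns ` X)" if "X \<subseteq> {..<length A}" for X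
    using that U by (subst sum.reindex[OF inj_on_subset[OF inj]]) (auto intro!: sum.cong)
  have greedy: "greedy (adj_nbhd A) ?U xs ?K = greedy ?N u (map (nth ns) xs) ?k"
    by (rule greedy_map[where I = "{..<length A}"]) (use nb xs inj U K sum_U in auto)
  have feasible: "(\<exists>f. gdf_feasible V E k u f) \<longleftrightarrow>
      (\<forall>v<length A. s ''k'' v \<le> sum ?U (adj_nbhd A v))"
    unfolding gdf_feasible_iff using nb K sum_U by (auto simp: V)
  have "gdf_output V E k u s'"
    if "s' ''feasible'' 0 = (if \<forall>v<length A. s ''k'' v \<le> sum ?U (adj_nbhd A v) then 1 else 0)"
      "s' ''opt'' 0 = sum ?U {..<length A} - greedy (adj_nbhd A) ?U xs ?K" for s'
  proof (cases "\<exists>f. gdf_feasible V E k u f")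
    case True
    have "is_gdf_minimum V E k u (sum u V - greedy ?N u vs ?k)"
      using True gdf_feasible_iff[of V E k u] greedy_gpf_maximum[OF graph seo]
      by (intro gdf_minimum_from_gpf_maximum) auto
    then show ?thesis
      using that True feasible greedy vs sum_U[of "{..<length A}"]
      by (simp add: gdf_output_def flip: V)
  next
    case False
    \<comment> \<open>On an infeasible instance only the flag is specified; the value in
      \<open>opt\<close> comes from truncated capacities and has no meaning.\<close>
    then show ?thesis unfolding gdf_output_def using that(1) feasible by (simp only: if_False)
  qed
  moreover have "\<forall>v\<ge>length A. s ''k'' v = 0"
    using k len by (simp add: array_def)
  note gdf_com_runs[OF input xs init this]
  ultimately show ?thesis
    unfolding halts_within_runs using cards by (elim runs_mono) auto
qed

text \<open>Program and time bound are chosen before the instance, so one program and one linear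
  function serve all graphs, orderings and bounds.\<close>

theorem theorem5:
  "(\<exists>(P :: com) (T :: nat \<Rightarrow> nat). (\<lambda>N. real (T N)) \<in> O(\<lambda>N. real N) \<and>
      (\<forall>(V :: 'a set) E vs k u s.
         simple_graph V E \<longrightarrow> strong_elimination_ordering V E vs \<longrightarrow>
         encodes_instance s V E vs k u \<longrightarrow>
         halts_within P s (T (card V + card E)) (gdf_output V E k u))) \<and>
   (\<exists>(P :: com) (T :: nat \<Rightarrow> nat). (\<lambda>N. real (T N)) \<in> O(\<lambda>N. real N) \<and>
      (\<forall>(V :: 'a set) E vs k u s.
         simple_graph V E \<longrightarrow> strong_elimination_ordering V E vs \<longrightarrow>
         encodes_instance s V E vs k u \<longrightarrow>
         halts_within P s (T (card V + card E)) (gpf_output V E k u)))"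
proof (intro conjI)
  show "\<exists>(P :: com) (T :: nat \<Rightarrow> nat). (\<lambda>N. real (T N)) \<in> O(\<lambda>N. real N) \<and>
      (\<forall>(V :: 'a set) E vs k u s.
         simple_graph V E \<longrightarrow> strong_elimination_ordering V E vs \<longrightarrow>
         encodes_instance s V E vs k u \<longrightarrow>
         halts_within P s (T (card V + card E)) (gdf_output V E k u))"
    using gdf_com_correct linear_bigo
    by (intro exI[of _ gdf_com] exI[of _ "\<lambda>N. 400 * N + 100"]) blast
  show "\<exists>(P :: com) (T :: nat \<Rightarrow> nat). (\<lambda>N. real (T N)) \<in> O(\<lambda>N. real N) \<and>
      (\<forall>(V :: 'a set) E vs k u s.
         simple_graph V E \<longrightarrow> strong_elimination_ordering V E vs \<longrightarrow>
         encodes_instance s V E vs k u \<longrightarrow>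
         halts_within P s (T (card V + card E)) (gpf_output V E k u))"
    using gpf_com_correct linear_bigo
    by (intro exI[of _ gpf_com] exI[of _ "\<lambda>N. 400 * N + 100"]) blast
qed

end
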